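(* Let $G$ be a group with a finite generating set $X$. If $(G,X)$ has the basepoint loop shortening property, then $(G,X)$ is almost convex.
   Context: $X^*$ denotes the set of all words in the letters of $X$ and their inverses, including the empty word, and $\Gamma(G,X)$ is the Cayley graph, a metric graph with edges of length $1$ and path metric $d$. A word $w\in X^*$ together with a starting vertex determines a path in $\Gamma(G,X)$ (called a path in $(G,X)$), of length $|w|$ equal to the number of letters. A loop is a path which starts and ends at the same vertex; it is based at that vertex. A path or loop $w$ is parameterized by arc length: $w(t)$ is the point at distance $t$ along $w$ from its start point for $0\le t\le|w|$, and $w(t)$ is the endpoint of $w$ for $t>|w|$. Two paths (or loops) $w,u$ $k$-fellow travel if $d(w(t),u(t))\le k$ for all real $t\ge 0$. $(G,X)$ has the basepoint loop shortening property if there is a constant $k>0$ such that for each loop $w$ in $(G,X)$ of positive length, based at $w(0)$, there is a loop $u$ in $(G,X)$ based at $w(0)$ with $|u|<|w|$ such that $w,u$ $k$-fellow travel. $(G,X)$ is almost convex if there is a constant $C$ such that for every $N\in\mathbb{N}$, every pair of points (vertices) of $\Gamma(G,X)$ lying distance at most $2$ apart and within distance $N$ of the identity are connected by a path of length at most $C$ which lies within distance $N$ of the identity. *)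

theory Defs
  imports Complex_Main "HOL-Algebra.Generated_Groups"
begin

text \<open>
  The Cayley graph has vertex set G and, for every g in G and x in X, one edge (g, x)
  running from g to gx, identified with the unit interval. \<open>Inner g x s\<close> is the point at
  distance s from g in the interior of that edge, so only 0 < s < 1 is used.
  Edges are indexed by pairs (g, x): if x is an involution, then (g, x) and (gx, x) are
  two distinct edges between the same vertices, and x = 1 gives loop edges.
\<close>

datatype 'a cayley_point = Vertex 'a | Inner 'a 'a real

definition edge_point ::
    "('a, 'b) monoid_scheme \<Rightarrow> 'a \<Rightarrow> 'a \<Rightarrow> real \<Rightarrow> 'a cayley_point" where
  "edge_point G g x s =
    (if s = 0 then Vertex g
     else if s = 1 then Vertex (g \<otimes>\<^bsub>G\<^esub> x)
     else Inner g x s)"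

text \<open>
  \<open>joined G X p L q\<close> says that p and q are joined by a piecewise linear path of length L:
  a finite concatenation of segments, each contained in a single closed edge. The path metric
  is the infimum of these lengths. (It is a genuine infimum of a nonempty set
  when X generates G and p, q are points of the graph.)
\<close>

inductive joined ::
    "('a, 'b) monoid_scheme \<Rightarrow> 'a set \<Rightarrow> 'a cayley_point \<Rightarrow> real \<Rightarrow> 'a cayley_point \<Rightarrow> bool"
  for G :: "('a, 'b) monoid_scheme" and X :: "'a set" and p :: "'a cayley_point" where
  joined_refl: "joined G X p 0 p"
| joined_step:
    "\<lbrakk> joined G X p L (edge_point G g x s); g \<in> carrier G; x \<in> X;
       0 \<le> s; s \<le> 1; 0 \<le> r; r \<le> 1 \<rbrakk>
     \<Longrightarrow> joined G X p (L + \<bar>s - r\<bar>) (edge_point G g x r)"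

definition cayley_dist ::
    "('a, 'b) monoid_scheme \<Rightarrow> 'a set \<Rightarrow> 'a cayley_point \<Rightarrow> 'a cayley_point \<Rightarrow> real" where
  "cayley_dist G X p q = Inf {L. joined G X p L q}"

datatype 'a letter = Pos 'a | Neg 'a

text \<open>Words are not required to be reduced.\<close>

definition words :: "'a set \<Rightarrow> 'a letter list set" where
  "words X = lists (Pos ` X \<union> Neg ` X)"

fun letter_value :: "('a, 'b) monoid_scheme \<Rightarrow> 'a letter \<Rightarrow> 'a" where
  "letter_value G (Pos x) = x"
| "letter_value G (Neg x) = inv\<^bsub>G\<^esub> x"

definition path_end :: "('a, 'b) monoid_scheme \<Rightarrow> 'a \<Rightarrow> 'a letter list \<Rightarrow> 'a" where
  "path_end G g w = foldl (\<lambda>h a. h \<otimes>\<^bsub>G\<^esub> letter_value G a) g w"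

text \<open>
  The point at distance f (between 0 and 1) from the vertex h on the edge leaving h along a letter.
  The letter \<open>Neg x\<close> traverses the edge from \<open>h \<otimes> inv x\<close> to h backwards.
\<close>

fun letter_point ::
    "('a, 'b) monoid_scheme \<Rightarrow> 'a \<Rightarrow> 'a letter \<Rightarrow> real \<Rightarrow> 'a cayley_point" where
  "letter_point G h (Pos x) f = edge_point G h x f"
| "letter_point G h (Neg x) f = edge_point G (h \<otimes>\<^bsub>G\<^esub> inv\<^bsub>G\<^esub> x) x (1 - f)"

text \<open>
  Arc length parameterization w(t), for t \<open>\<ge>\<close> 0, of the path labelled w starting at g.
\<close>

definition path_point ::
    "('a, 'b) monoid_scheme \<Rightarrow> 'a \<Rightarrow> 'a letter list \<Rightarrow> real \<Rightarrow> 'a cayley_point" where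
  "path_point G g w t =
    (if t < real (length w)
     then letter_point G (path_end G g (take (nat \<lfloor>t\<rfloor>) w)) (w ! nat \<lfloor>t\<rfloor>) (frac t)
     else Vertex (path_end G g w))"

definition loop_at :: "('a, 'b) monoid_scheme \<Rightarrow> 'a set \<Rightarrow> 'a \<Rightarrow> 'a letter list \<Rightarrow> bool" where
  "loop_at G X g w \<longleftrightarrow> g \<in> carrier G \<and> w \<in> words X \<and> path_end G g w = g"

definition fellow_travel ::
    "('a, 'b) monoid_scheme \<Rightarrow> 'a set \<Rightarrow> real \<Rightarrow> 'a \<Rightarrow> 'a letter list \<Rightarrow> 'a \<Rightarrow> 'a letter list \<Rightarrow> bool"
  where
  "fellow_travel G X k g w h u \<longleftrightarrow>
    (\<forall>t\<ge>0. cayley_dist G X (path_point G g w t) (path_point G h u t) \<le> k)"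

definition basepoint_loop_shortening :: "('a, 'b) monoid_scheme \<Rightarrow> 'a set \<Rightarrow> bool" where
  "basepoint_loop_shortening G X \<longleftrightarrow>
    (\<exists>k>0. \<forall>g w. loop_at G X g w \<and> length w > 0 \<longrightarrow>
      (\<exists>u. loop_at G X g u \<and> length u < length w \<and> fellow_travel G X k g w g u))"

text \<open>
  The connecting path must stay in the ball of radius N of the metric graph with all its points,
  including those in the interiors of edges.
\<close>

definition almost_convex :: "('a, 'b) monoid_scheme \<Rightarrow> 'a set \<Rightarrow> bool" where
  "almost_convex G X \<longleftrightarrow>
    (\<exists>C::real. \<forall>N::nat. \<forall>g\<in>carrier G. \<forall>h\<in>carrier G.
      cayley_dist G X (Vertex g) (Vertex h) \<le> 2 \<and>
      cayley_dist G X (Vertex \<one>\<^bsub>G\<^esub>) (Vertex g) \<le> real N \<and>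
      cayley_dist G X (Vertex \<one>\<^bsub>G\<^esub>) (Vertex h) \<le> real N \<longrightarrow>
      (\<exists>w\<in>words X. path_end G g w = h \<and> real (length w) \<le> C \<and>
        (\<forall>t. 0 \<le> t \<and> t \<le> real (length w) \<longrightarrow>
          cayley_dist G X (Vertex \<one>\<^bsub>G\<^esub>) (path_point G g w t) \<le> real N)))"

end

theory Submission imports Defs begin

text \<open>
  Let g and h be vertices in the ball of radius N about the identity, at distance at most 2.
  Going from the identity to g, across to h, and back along words of length at most N gives a loop
  of length at most \<open>2 * N + 2\<close> based at the identity. Shortening it twice gives a based
  loop u of length at most \<open>2 * N\<close>, and such a loop lies entirely in the ball of radius N,
  because each of its points can return to the base point along the shorter of its two arcs. So
  the top of the original loop, which may leave the ball, can be replaced by an arc of u.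

  It remains to get from g and h to u without leaving the ball. Both shortenings are k-fellow
  travelling, so corresponding points of the two loops are within \<open>2 * k\<close> of each
  other. A connection starting at g itself might leave the ball; but after first descending
  \<open>2 * k\<close> steps from g towards the identity there is room for it
  (\<open>descend_and_jump\<close>). The same works at h. The descents, the connections and the
  arc of u have total length bounded in terms of k alone. A descent that reaches the identity
  early needs no connection, since all the loops pass through the base point.

  The work in vertices and words is tied to the metric graph by two facts: the path metric
  between vertices is the word metric (\<open>near_if_cayley_dist_le\<close>), and a path all of
  whose edges satisfy the condition \<open>edge_ok\<close> stays in the ball together with the
  interiors of its edges (\<open>cayley_dist_path_point_le\<close>).
\<close>

section \<open>Words as paths in the Cayley graph\<close>

lemma path_end_Nil [simp]: "path_end G g [] = g"
  by (simp add: path_end_def)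

lemma path_end_Cons [simp]: "path_end G g (a # w) = path_end G (g \<otimes>\<^bsub>G\<^esub> letter_value G a) w"
  by (simp add: path_end_def)

lemma path_end_append [simp]: "path_end G g (v @ w) = path_end G (path_end G g v) w"
  by (simp add: path_end_def)

fun flip_letter :: "'a letter \<Rightarrow> 'a letter" where
  "flip_letter (Pos x) = Neg x"
| "flip_letter (Neg x) = Pos x"

definition inv_word :: "'a letter list \<Rightarrow> 'a letter list" where
  "inv_word w = rev (map flip_letter w)"

lemma inv_word_Nil [simp]: "inv_word [] = []"
  by (simp add: inv_word_def)

lemma inv_word_Cons [simp]: "inv_word (a # w) = inv_word w @ [flip_letter a]"
  by (simp add: inv_word_def)

lemma length_inv_word [simp]: "length (inv_word w) = length w"
  by (simp add: inv_word_def)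

lemma take_inv_word: "take t (inv_word w) = inv_word (drop (length w - t) w)"
  by (simp add: inv_word_def take_rev drop_map)

lemma words_Nil [simp]: "[] \<in> words X"
  by (simp add: words_def)

lemma words_Cons [simp]: "a # w \<in> words X \<longleftrightarrow> a \<in> Pos ` X \<union> Neg ` X \<and> w \<in> words X"
  by (auto simp: words_def)

lemma words_append [simp]: "v @ w \<in> words X \<longleftrightarrow> v \<in> words X \<and> w \<in> words X"
  by (auto simp: words_def)

lemma flip_letter_mem: "a \<in> Pos ` X \<union> Neg ` X \<Longrightarrow> flip_letter a \<in> Pos ` X \<union> Neg ` X"
  by auto

lemma words_inv_word [simp]: "w \<in> words X \<Longrightarrow> inv_word w \<in> words X"
proof (induction w)
  case (Cons a w)
  then show ?case
    using flip_letter_mem[of a X] by simp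
qed simp

lemma words_take [simp]: "w \<in> words X \<Longrightarrow> take i w \<in> words X"
  by (metis append_take_drop_id words_append)

lemma words_drop [simp]: "w \<in> words X \<Longrightarrow> drop i w \<in> words X"
  by (metis append_take_drop_id words_append)

lemma path_point_Cons:
  assumes "0 \<le> t"
  shows "path_point G g (a # w) t =
    (if t < 1 then letter_point G g a t else path_point G (g \<otimes>\<^bsub>G\<^esub> letter_value G a) w (t - 1))"
proof (cases "t < 1")
  case True
  then have "\<lfloor>t\<rfloor> = 0"
    using assms by linarith
  then show ?thesis
    using True assms by (simp add: path_point_def frac_def)
next
  case False
  then have "nat \<lfloor>t\<rfloor> = Suc (nat \<lfloor>t - 1\<rfloor>)"
    by linarith
  moreover have "frac (t - 1) = frac t"
    by (simp add: frac_def)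
  ultimately show ?thesis
    using False by (simp add: path_point_def)
qed

lemma joined_nonneg: "joined G X p L q \<Longrightarrow> 0 \<le> L"
  by (induction rule: joined.induct) auto

lemma cayley_dist_le:
  assumes "joined G X p L q"
  shows "cayley_dist G X p q \<le> L"
  unfolding cayley_dist_def
proof (rule cInf_lower)
  show "bdd_below {L. joined G X p L q}"
    by (rule bdd_belowI[of _ 0]) (auto dest: joined_nonneg)
qed (use assms in simp)

locale cayley_graph = group G for G :: "('a, 'b) monoid_scheme" (structure) +
  fixes X :: "'a set"
  assumes gens_closed: "X \<subseteq> carrier G"
    and gens_generate: "generate G X = carrier G"
begin

abbreviation letters :: "'a letter set" where
  "letters \<equiv> Pos ` X \<union> Neg ` X"

lemma letter_value_closed [simp]: "a \<in> letters \<Longrightarrow> letter_value G a \<in> carrier G"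
  using gens_closed by auto

lemma path_end_closed [simp]:
  "g \<in> carrier G \<Longrightarrow> w \<in> words X \<Longrightarrow> path_end G g w \<in> carrier G"
  by (induction w arbitrary: g) (simp_all del: Un_iff)

lemma step_flip_letter:
  assumes "g \<in> carrier G" "a \<in> letters"
  shows "g \<otimes> letter_value G a \<otimes> letter_value G (flip_letter a) = g"
proof -
  have "letter_value G a \<otimes> letter_value G (flip_letter a) = \<one>"
    using assms(2) gens_closed by auto
  then show ?thesis
    using assms letter_value_closed[of a] letter_value_closed[OF flip_letter_mem, of a]
    by (simp add: m_assoc del: Un_iff)
qed

lemma path_end_inv_word:
  "g \<in> carrier G \<Longrightarrow> w \<in> words X \<Longrightarrow> path_end G (path_end G g w) (inv_word w) = g"
  by (induction w arbitrary: g) (simp_all add: step_flip_letter del: Un_iff)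

lemma path_end_take_inv_word:
  assumes "g \<in> carrier G" "w \<in> words X"
  shows "path_end G (path_end G g w) (take t (inv_word w)) = path_end G g (take (length w - t) w)"
proof -
  let ?v = "take (length w - t) w" and ?d = "drop (length w - t) w"
  have "path_end G g w = path_end G (path_end G g ?v) ?d"
    by (metis append_take_drop_id path_end_append)
  then show ?thesis
    using path_end_inv_word[of "path_end G g ?v" ?d] assms by (simp add: take_inv_word)
qed

lemma path_end_translate:
  assumes "g \<in> carrier G" "h \<in> carrier G" "w \<in> words X"
  shows "path_end G (g \<otimes> h) w = g \<otimes> path_end G h w"
  using assms by (induction w arbitrary: h) (simp_all add: m_assoc del: Un_iff)

section \<open>The path metric and the word metric\<close>

definition near :: "nat \<Rightarrow> 'a \<Rightarrow> 'a \<Rightarrow> bool" where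
  "near n g h \<longleftrightarrow> (\<exists>w\<in>words X. path_end G g w = h \<and> length w \<le> n)"

lemma near_path: "w \<in> words X \<Longrightarrow> near (length w) g (path_end G g w)"
  by (auto simp: near_def)

lemma near_refl [simp]: "near n g g"
  unfolding near_def by (rule bexI[of _ "[]"]) auto

lemma near_mono: "near m g h \<Longrightarrow> m \<le> n \<Longrightarrow> near n g h"
  by (auto simp: near_def)

lemma near_trans: "near m f g \<Longrightarrow> near n g h \<Longrightarrow> near (m + n) f h"
  unfolding near_def
proof (elim bexE conjE)
  fix v w
  assume "v \<in> words X" "w \<in> words X" "path_end G f v = g" "path_end G g w = h"
    "length v \<le> m" "length w \<le> n"
  then show "\<exists>u\<in>words X. path_end G f u = h \<and> length u \<le> m + n"
    by (intro bexI[of _ "v @ w"]) auto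
qed

lemma near_sym:
  assumes "g \<in> carrier G" "near n g h"
  shows "near n h g"
proof -
  obtain w where "w \<in> words X" "path_end G g w = h" "length w \<le> n"
    using assms(2) by (auto simp: near_def)
  then show ?thesis
    unfolding near_def using path_end_inv_word[OF assms(1)]
    by (intro bexI[of _ "inv_word w"]) auto
qed

lemma near_edge: "x \<in> X \<Longrightarrow> near (Suc 0) g (g \<otimes> x)"
  using near_path[of "[Pos x]" g] by simp

lemma near_edge_back:
  assumes "g \<in> carrier G" "x \<in> X"
  shows "near (Suc 0) (g \<otimes> x) g"
  using near_sym[OF assms(1) near_edge[OF assms(2)]] .

lemma word_exists:
  assumes "g \<in> carrier G" "h \<in> carrier G"
  shows "\<exists>w\<in>words X. path_end G g w = h"
proof -
  have from_one: "\<exists>w\<in>words X. path_end G \<one> w = y" if "y \<in> generate G X" for y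
    using that
  proof (induction rule: generate.induct)
    case one
    show ?case by (rule bexI[of _ "[]"]) auto
  next
    case (incl x)
    then show ?case using gens_closed by (intro bexI[of _ "[Pos x]"]) auto
  next
    case (inv x)
    then show ?case using gens_closed by (intro bexI[of _ "[Neg x]"]) auto
  next
    case (eng y z)
    then obtain v w where vw: "v \<in> words X" "path_end G \<one> v = y" "w \<in> words X" "path_end G \<one> w = z"
      by blast
    moreover have "y \<in> carrier G"
      using eng gens_generate by simp
    ultimately have "path_end G y w = y \<otimes> z"
      using path_end_translate[of y \<one> w] by simp
    then show ?case using vw by (intro bexI[of _ "v @ w"]) auto
  qed
  obtain w where "w \<in> words X" "path_end G \<one> w = inv g \<otimes> h"
    using from_one[of "inv g \<otimes> h"] gens_generate assms by auto
  then show ?thesis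
    using path_end_translate[of g \<one> w] assms by (auto simp flip: m_assoc)
qed

text \<open>
  The invariant that a path of length L starting at the vertex g satisfies at its current point.
  Such a path can enter the interior of an edge only through one of the endpoints, which
  accounts for the two alternatives at an interior point.
\<close>

fun word_bound :: "'a \<Rightarrow> real \<Rightarrow> 'a cayley_point \<Rightarrow> bool" where
  "word_bound g L (Vertex h) \<longleftrightarrow> (\<exists>n. near n g h \<and> real n \<le> L)"
| "word_bound g L (Inner h x s) \<longleftrightarrow>
    (\<exists>n. near n g h \<and> real n + s \<le> L) \<or> (\<exists>n. near n g (h \<otimes> x) \<and> real n + (1 - s) \<le> L)"

lemma word_bound_edge_point:
  assumes "h \<in> carrier G" "x \<in> X" "0 \<le> s" "s \<le> 1"
  shows "word_bound g L (edge_point G h x s) \<longleftrightarrow>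
    (\<exists>n. near n g h \<and> real n + s \<le> L) \<or> (\<exists>n. near n g (h \<otimes> x) \<and> real n + (1 - s) \<le> L)"
proof -
  have fwd: "near (Suc n) g (h \<otimes> x)" if "near n g h" for n
    using near_trans[OF that near_edge[OF assms(2)]] by simp
  have bwd: "near (Suc n) g h" if "near n g (h \<otimes> x)" for n
    using near_trans[OF that near_edge_back[OF assms(1,2)]] by simp
  consider "s = 0" | "s = 1" | "s \<noteq> 0" "s \<noteq> 1" by blast
  then show ?thesis
  proof cases
    case 1
    have "\<exists>n. near n g h \<and> real n \<le> L" if "near n g (h \<otimes> x)" "real n + 1 \<le> L" for n
      using bwd[OF that(1)] that(2) by (intro exI[of _ "Suc n"]) auto
    then show ?thesis using 1 by (auto simp: edge_point_def)
  next
    case 2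
    have "\<exists>n. near n g (h \<otimes> x) \<and> real n \<le> L" if "near n g h" "real n + 1 \<le> L" for n
      using fwd[OF that(1)] that(2) by (intro exI[of _ "Suc n"]) auto
    then show ?thesis using 2 by (auto simp: edge_point_def)
  next
    case 3
    then show ?thesis by (simp add: edge_point_def)
  qed
qed

lemma joined_word_bound: "joined G X (Vertex g) L q \<Longrightarrow> word_bound g L q"
proof (induction rule: joined.induct)
  case joined_refl
  show ?case by (auto intro: exI[of _ 0])
next
  case (joined_step L h x s r)
  then consider n where "near n g h" "real n + s \<le> L"
    | n where "near n g (h \<otimes> x)" "real n + (1 - s) \<le> L"
    using word_bound_edge_point by blast
  then have "(\<exists>n. near n g h \<and> real n + r \<le> L + \<bar>s - r\<bar>) \<or>
    (\<exists>n. near n g (h \<otimes> x) \<and> real n + (1 - r) \<le> L + \<bar>s - r\<bar>)"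
  proof cases
    case 1
    then show ?thesis by (intro disjI1 exI[of _ n]) auto
  next
    case 2
    then show ?thesis by (intro disjI2 exI[of _ n]) auto
  qed
  then show ?case
    using joined_step word_bound_edge_point by blast
qed

lemma letter_point_0:
  assumes "g \<in> carrier G" "a \<in> letters"
  shows "letter_point G g a 0 = Vertex g"
  using assms gens_closed by (auto simp: edge_point_def m_assoc subset_iff)

lemma letter_point_1:
  assumes "g \<in> carrier G" "a \<in> letters"
  shows "letter_point G g a 1 = Vertex (g \<otimes> letter_value G a)"
  using assms by (auto simp: edge_point_def)

lemma joined_letter_point:
  assumes "joined G X p L (letter_point G h a s)" "h \<in> carrier G" "a \<in> letters"
    and "0 \<le> s" "s \<le> 1" "0 \<le> r" "r \<le> 1"
  shows "joined G X p (L + \<bar>s - r\<bar>) (letter_point G h a r)"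
proof (cases a)
  case (Pos x)
  then show ?thesis using assms by (auto intro: joined_step)
next
  case (Neg x)
  then have x: "x \<in> X" "h \<otimes> inv x \<in> carrier G"
    using assms(2,3) gens_closed by auto
  show ?thesis
    using joined_step[of G X p L "h \<otimes> inv x" x "1 - s" "1 - r"] assms x Neg
    by (simp add: abs_minus_commute)
qed

lemma joined_path:
  assumes "joined G X p L (Vertex g)" "g \<in> carrier G" "w \<in> words X"
  shows "joined G X p (L + real (length w)) (Vertex (path_end G g w))"
  using assms
proof (induction w arbitrary: L g)
  case (Cons a w)
  then have a: "a \<in> letters" by simp
  have "joined G X p (L + \<bar>0 - 1\<bar>) (letter_point G g a 1)"
    using Cons.prems a by (intro joined_letter_point) (auto simp: letter_point_0 simp del: Un_iff)
  then have "joined G X p (L + 1) (Vertex (g \<otimes> letter_value G a))"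
    using Cons.prems(2) a by (simp add: letter_point_1 del: Un_iff)
  from Cons.IH[OF this] Cons.prems a show ?case
    by (simp add: add.assoc del: Un_iff)
qed simp

lemma near_if_cayley_dist_le:
  assumes "g \<in> carrier G" "h \<in> carrier G" "cayley_dist G X (Vertex g) (Vertex h) \<le> r"
  shows "near (nat \<lfloor>r\<rfloor>) g h"
proof -
  let ?S = "{L. joined G X (Vertex g) L (Vertex h)}"
  obtain w where "w \<in> words X" "path_end G g w = h"
    using word_exists assms by blast
  then have "?S \<noteq> {}"
    using joined_path[OF joined_refl assms(1)] by auto
  moreover have "Inf ?S < \<lfloor>r\<rfloor> + 1"
    using assms(3) unfolding cayley_dist_def by linarith
  ultimately obtain L where "joined G X (Vertex g) L (Vertex h)" "L < \<lfloor>r\<rfloor> + 1"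
    using cInf_lessD[of ?S] by blast
  then obtain n where "near n g h" "real n < \<lfloor>r\<rfloor> + 1"
    using joined_word_bound by fastforce
  then show ?thesis
    by (elim near_mono) linarith
qed

lemma joined_if_near:
  assumes "g \<in> carrier G" "near n g h"
  obtains L where "joined G X (Vertex g) L (Vertex h)" "L \<le> real n"
proof -
  obtain w where w: "w \<in> words X" "path_end G g w = h" "length w \<le> n"
    using assms(2) by (auto simp: near_def)
  then show thesis
    using that[of "real (length w)"] joined_path[OF joined_refl assms(1) w(1)] by simp
qed

section \<open>Paths in a ball about the identity\<close>

text \<open>
  The points of an edge can be reached from the identity through either endpoint. If the endpoints
  are at distances p and q, the point at distance f from the first one is within \<open>p + f\<close>
  and within \<open>q + 1 - f\<close>; the smaller of these is at most N for every f once
  \<open>p + q + 1 \<le> 2 * N\<close>.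
\<close>

definition edge_ok :: "nat \<Rightarrow> 'a \<Rightarrow> 'a \<Rightarrow> bool" where
  "edge_ok N g h \<longleftrightarrow> (\<exists>p q. near p \<one> g \<and> near q \<one> h \<and> p + q + 1 \<le> 2 * N)"

lemma edge_ok_sym: "edge_ok N g h \<Longrightarrow> edge_ok N h g"
  unfolding edge_ok_def by (metis add.commute)

fun in_ball :: "nat \<Rightarrow> 'a \<Rightarrow> 'a letter list \<Rightarrow> bool" where
  "in_ball N g [] \<longleftrightarrow> near N \<one> g"
| "in_ball N g (a # w) \<longleftrightarrow> near N \<one> g \<and> edge_ok N g (g \<otimes> letter_value G a) \<and>
    in_ball N (g \<otimes> letter_value G a) w"

lemma in_ball_start: "in_ball N g w \<Longrightarrow> near N \<one> g"
  by (cases w) auto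

lemma in_ball_append:
  "in_ball N g (v @ w) \<longleftrightarrow> in_ball N g v \<and> in_ball N (path_end G g v) w"
  by (induction v arbitrary: g) (auto dest: in_ball_start)

lemma in_ball_inv_word:
  "g \<in> carrier G \<Longrightarrow> w \<in> words X \<Longrightarrow> in_ball N g w \<Longrightarrow> in_ball N (path_end G g w) (inv_word w)"
proof (induction w arbitrary: g)
  case (Cons a w)
  let ?h = "g \<otimes> letter_value G a"
  have a: "a \<in> letters" and w: "w \<in> words X" using Cons.prems by auto
  have h: "?h \<in> carrier G" using a Cons.prems(1) by (simp del: Un_iff)
  have "edge_ok N ?h g" "near N \<one> ?h" "near N \<one> g"
    using Cons.prems(3) in_ball_start[of N ?h w] by (auto intro: edge_ok_sym)
  moreover have "in_ball N (path_end G ?h w) (inv_word w)"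
    using Cons.IH[OF h w] Cons.prems(3) by simp
  ultimately show ?case
    using h w path_end_inv_word[OF h w] step_flip_letter[OF Cons.prems(1) a]
    by (simp add: in_ball_append)
qed simp

text \<open>
  The half-perimeter principle: if a path extends to a loop through the identity of length at most
  \<open>2 * N\<close>, every point of the path returns to the identity within N along one of the two
  arcs.
\<close>

lemma in_ball_if_short_detour:
  assumes "w \<in> words X" "g \<in> carrier G" "near p \<one> g" "near q \<one> (path_end G g w)"
    and "p + length w + q \<le> 2 * N"
  shows "in_ball N g w"
  using assms
proof (induction w arbitrary: g p)
  case Nil
  then have "p \<le> N \<or> q \<le> N" by auto
  then show ?case using Nil near_mono by auto
next
  case (Cons a w)
  let ?h = "g \<otimes> letter_value G a"
  have a: "a \<in> letters" and w: "w \<in> words X" using Cons.prems(1) by auto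
  have h: "?h \<in> carrier G" using a Cons.prems(2) by (simp del: Un_iff)
  have end_h: "near q \<one> (path_end G ?h w)" using Cons.prems(4) by simp
  have ph: "near (p + 1) \<one> ?h"
    using near_trans[OF Cons.prems(3) near_path[of "[a]" g]] a by (simp del: Un_iff)
  have qh: "near (length w + q) \<one> ?h"
    using near_trans[OF end_h near_sym[OF h near_path[OF w]]] by (simp add: add.commute)
  have qg: "near (length w + 1 + q) \<one> g"
    using near_trans[OF Cons.prems(4) near_sym[OF Cons.prems(2) near_path[OF Cons.prems(1)]]]
    by (simp add: add.commute[of q])
  have "p \<le> N \<or> length w + 1 + q \<le> N" using Cons.prems(5) by auto
  then have "near N \<one> g"
    using near_mono Cons.prems(3) qg by blast
  moreover have "edge_ok N g ?h"
    unfolding edge_ok_def using Cons.prems(3,5) qh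
    by (intro exI[of _ p] exI[of _ "length w + q"]) auto
  moreover have "in_ball N ?h w"
    using Cons.IH[OF w h ph] Cons.prems(4,5) by simp
  ultimately show ?case by simp
qed

lemma cayley_dist_letter_point_le:
  assumes "h \<in> carrier G" "a \<in> letters" "edge_ok N h (h \<otimes> letter_value G a)" "0 \<le> f" "f \<le> 1"
  shows "cayley_dist G X (Vertex \<one>) (letter_point G h a f) \<le> real N"
proof -
  obtain p q where pq: "near p \<one> h" "near q \<one> (h \<otimes> letter_value G a)" "p + q + 1 \<le> 2 * N"
    using assms(3) by (auto simp: edge_ok_def)
  obtain L where L: "joined G X (Vertex \<one>) L (letter_point G h a 0)" "L \<le> real p"
    using joined_if_near[OF one_closed pq(1)] letter_point_0[OF assms(1,2)] by metis
  obtain M where M: "joined G X (Vertex \<one>) M (letter_point G h a 1)" "M \<le> real q"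
    using joined_if_near[OF one_closed pq(2)] letter_point_1[OF assms(1,2)] by metis
  have "cayley_dist G X (Vertex \<one>) (letter_point G h a f) \<le> L + \<bar>0 - f\<bar>"
    using assms L by (intro cayley_dist_le joined_letter_point) auto
  moreover have "cayley_dist G X (Vertex \<one>) (letter_point G h a f) \<le> M + \<bar>1 - f\<bar>"
    using assms M by (intro cayley_dist_le joined_letter_point) auto
  moreover have "real p + real q + 1 \<le> 2 * real N"
    using pq(3) by linarith
  ultimately show ?thesis using L(2) M(2) assms(4,5) by linarith
qed

lemma cayley_dist_path_point_le:
  assumes "g \<in> carrier G" "w \<in> words X" "in_ball N g w" "0 \<le> t"
  shows "cayley_dist G X (Vertex \<one>) (path_point G g w t) \<le> real N"
  using assms
proof (induction w arbitrary: g t)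
  case Nil
  then obtain L where "joined G X (Vertex \<one>) L (Vertex g)" "L \<le> real N"
    using joined_if_near[of \<one> N g] by auto
  then show ?case
    using cayley_dist_le Nil.prems(4) by (fastforce simp: path_point_def)
next
  case (Cons a w)
  have a: "a \<in> letters" and w: "w \<in> words X" using Cons.prems by auto
  show ?case
  proof (cases "t < 1")
    case True
    then show ?thesis
      using Cons.prems a cayley_dist_letter_point_le[OF Cons.prems(1) a, of N t]
      by (simp add: path_point_Cons)
  next
    case False
    then show ?thesis
      using Cons.IH[of "g \<otimes> letter_value G a" "t - 1"] Cons.prems a w
      by (simp add: path_point_Cons del: Un_iff)
  qed
qed

section \<open>Shortening a loop and descending to it\<close>

lemma path_point_vertex:
  assumes "g \<in> carrier G" "w \<in> words X"
  shows "path_point G g w (real i) = Vertex (path_end G g (take i w))"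
proof (cases "i < length w")
  case True
  then have "w ! i \<in> letters"
    using assms(2) by (auto simp: words_def in_lists_conv_set)
  then show ?thesis
    using True assms letter_point_0[of "path_end G g (take i w)" "w ! i"]
    by (simp add: path_point_def frac_def del: Un_iff)
qed (simp add: path_point_def)

text \<open>
  The truncated subtraction covers the empty loop, which is kept as it is; so the lemma can be
  iterated even when the first shortening already reaches the empty loop.
\<close>

lemma shorten_loop:
  assumes shortening: "\<forall>g w. loop_at G X g w \<and> length w > 0 \<longrightarrow>
      (\<exists>u. loop_at G X g u \<and> length u < length w \<and> fellow_travel G X k g w g u)"
    and "loop_at G X g w"
  obtains u where "loop_at G X g u" "length u \<le> length w - 1"
    and "\<And>i. near (nat \<lfloor>k\<rfloor>) (path_end G g (take i w)) (path_end G g (take i u))"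
proof (cases "length w > 0")
  case True
  obtain u where u: "loop_at G X g u" "length u < length w" "fellow_travel G X k g w g u"
    using shortening assms(2) True by blast
  have loop: "g \<in> carrier G" "w \<in> words X" "u \<in> words X"
    using u(1) assms(2) by (auto simp: loop_at_def)
  have "near (nat \<lfloor>k\<rfloor>) (path_end G g (take i w)) (path_end G g (take i u))" for i
    using u(3) loop path_point_vertex[of g _ i, symmetric]
    by (intro near_if_cayley_dist_le) (auto simp: fellow_travel_def)
  then show thesis using that[of u] u by auto
next
  case False
  then show thesis using that[of w] assms(2) by auto
qed

text \<open>
  A jump of length m starting at distance i from the identity stays within \<open>i + m\<close>.
  Descending \<open>s \<ge> m\<close> steps from the end of the word a before jumping makes
  \<open>i + m\<close> at most \<open>length a\<close>, unless the descent is cut short at the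
  identity, where the jump is required to be trivial.
\<close>

lemma descend_and_jump:
  assumes a: "a \<in> words X" "length a \<le> N" and "m \<le> s"
    and jump: "near m (path_end G \<one> (take (length a - s) a)) v"
    and base: "length a \<le> s \<Longrightarrow> v = \<one>"
  obtains w where "w \<in> words X" "path_end G (path_end G \<one> a) w = v" "length w \<le> s + m"
    "in_ball N (path_end G \<one> a) w"
proof -
  define i where "i = length a - s"
  define h where "h = path_end G \<one> (take i a)"
  let ?d = "drop i a"
  have h: "h \<in> carrier G" "near i \<one> h"
    using a near_path[of "take i a" \<one>] by (auto simp: h_def i_def intro: near_mono)
  have end_d: "path_end G h ?d = path_end G \<one> a"
    unfolding h_def by (metis append_take_drop_id path_end_append)
  have "in_ball N h ?d"
    using h a near_path[OF a(1), of \<one>] end_d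
    by (intro in_ball_if_short_detour[of _ _ i "length a"]) (auto simp: i_def)
  then have down: "in_ball N (path_end G \<one> a) (inv_word ?d)" "inv_word ?d \<in> words X"
      "path_end G (path_end G \<one> a) (inv_word ?d) = h" "length (inv_word ?d) \<le> s"
    using in_ball_inv_word[of h ?d N] path_end_inv_word[of h ?d] end_d h a by (auto simp: i_def)
  show thesis
  proof (cases "length a \<le> s")
    case True
    then have "v = h" using base by (simp add: h_def i_def)
    then show thesis using that[of "inv_word ?d"] down by simp
  next
    case False
    obtain q where q: "q \<in> words X" "path_end G h q = v" "length q \<le> m"
      using jump by (auto simp: near_def h_def i_def)
    have "near (i + m) \<one> v"
      using near_trans[OF h(2)] jump by (simp add: h_def i_def)
    then have "in_ball N h q"
      using q h False a(2) assms(3)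
      by (intro in_ball_if_short_detour[of _ _ i "i + m"]) (auto simp: i_def)
    then show thesis
      using that[of "inv_word ?d @ q"] down q by (auto simp: in_ball_append)
  qed
qed

text \<open>
  With \<open>m = nat \<lfloor>k\<rfloor>\<close>, two shortenings move a vertex by at most \<open>2 * m\<close>. Descending
  \<open>2 * m\<close> and jumping \<open>2 * m\<close> at each end costs \<open>8 * m\<close> in total, and the arc of the shortened
  loop between the two landing points has length at most \<open>4 * m + 2\<close>: two descents and the
  crossing from g to h.
\<close>

lemma connect_in_ball:
  assumes shortening: "\<forall>g w. loop_at G X g w \<and> length w > 0 \<longrightarrow>
      (\<exists>u. loop_at G X g u \<and> length u < length w \<and> fellow_travel G X k g w g u)"
    and "near 2 g h" "near N \<one> g" "near N \<one> h"
  obtains w where "w \<in> words X" "path_end G g w = h" "length w \<le> 12 * nat \<lfloor>k\<rfloor> + 2" "in_ball N g w"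
proof -
  define m where "m = nat \<lfloor>k\<rfloor>"
  define s where "s = 2 * m"
  obtain a where a: "a \<in> words X" "path_end G \<one> a = g" "length a \<le> N"
    using assms(3) by (auto simp: near_def)
  obtain b where b: "b \<in> words X" "path_end G g b = h" "length b \<le> 2"
    using assms(2) by (auto simp: near_def)
  obtain c where c: "c \<in> words X" "path_end G \<one> c = h" "length c \<le> N"
    using assms(4) by (auto simp: near_def)
  define w0 where "w0 = a @ b @ inv_word c"
  have w0: "loop_at G X \<one> w0" "length w0 \<le> 2 * N + 2"
    using a b c path_end_inv_word[OF one_closed c(1)] by (auto simp: w0_def loop_at_def)
  obtain w1 where w1: "loop_at G X \<one> w1" "length w1 \<le> length w0 - 1"
      "\<And>i. near m (path_end G \<one> (take i w0)) (path_end G \<one> (take i w1))"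
    using shorten_loop[OF shortening w0(1)] m_def by blast
  obtain u where u: "loop_at G X \<one> u" "length u \<le> length w1 - 1"
      "\<And>i. near m (path_end G \<one> (take i w1)) (path_end G \<one> (take i u))"
    using shorten_loop[OF shortening w1(1)] m_def by blast
  have u_words: "u \<in> words X" and u_end: "path_end G \<one> u = \<one>"
    using u(1) by (auto simp: loop_at_def)
  have u_len: "length u \<le> 2 * N" "length u \<le> length w0"
    using u(2) w1(2) w0(2) by linarith+
  have close: "near s (path_end G \<one> (take i w0)) (path_end G \<one> (take i u))" for i
    using near_trans[OF w1(3) u(3), of i] by (simp add: s_def mult_2)
  define i where "i = length a - s"
  (* For s > length c this position lies beyond the end of both loops, where their paths rest at
     the base point. *)
  define j where "j = length a + length b + s"
  have ij: "i \<le> j" "j - i \<le> 2 * s + 2" using b(3) by (auto simp: i_def j_def)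
  define y where "y = path_end G \<one> (take i u)"
  define z where "z = path_end G \<one> (take j u)"
  obtain v where v: "v \<in> words X" "path_end G g v = y" "length v \<le> s + s" "in_ball N g v"
  proof (rule descend_and_jump[of a N s s y])
    show "near s (path_end G \<one> (take (length a - s) a)) y"
      using close[of i] by (simp add: y_def w0_def i_def)
  qed (use a in \<open>auto simp: y_def i_def\<close>)
  obtain v' where v': "v' \<in> words X" "path_end G h v' = z" "length v' \<le> s + s" "in_ball N h v'"
  proof (rule descend_and_jump[of c N s s z])
    have "path_end G \<one> (take j w0) = path_end G \<one> (take (length c - s) c)"
      using a b c path_end_take_inv_word[OF one_closed c(1), of s] by (simp add: w0_def j_def)
    then show "near s (path_end G \<one> (take (length c - s) c)) z"
      using close[of j] by (simp add: z_def)
    show "z = \<one>" if "length c \<le> s"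
    proof -
      have "length u \<le> j" using u_len(2) that by (simp add: w0_def j_def)
      then show ?thesis using u_end by (simp add: z_def)
    qed
  qed (use c in auto)
  define e where "e = take (j - i) (drop i u)"
  have e: "e \<in> words X" "length e \<le> 2 * s + 2" using u_words ij by (auto simp: e_def)
  have "take j u = take i u @ e"
    using ij take_add[of i "j - i" u] by (simp add: e_def)
  then have e_end: "path_end G y e = z" by (simp add: y_def z_def)
  have y: "y \<in> carrier G" "near (length (take i u)) \<one> y"
    using u_words near_path[of "take i u" \<one>] by (auto simp: y_def)
  have z: "z \<in> carrier G" "near (length (drop j u)) \<one> z"
  proof -
    show zc: "z \<in> carrier G" using u_words by (simp add: z_def)
    have "path_end G z (drop j u) = \<one>"
      unfolding z_def using u_end by (metis append_take_drop_id path_end_append)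
    then show "near (length (drop j u)) \<one> z"
      using near_sym[OF zc near_path[of "drop j u" z]] u_words by simp
  qed
  have "length (take i u) + length e + length (drop j u) = length u"
    using ij by (auto simp: e_def)
  then have "in_ball N y e"
    using e y z e_end u_len(1) by (intro in_ball_if_short_detour) auto
  moreover have "g \<in> carrier G" "h \<in> carrier G" using a b c by auto
  ultimately show thesis
    using that[of "v @ e @ inv_word v'"] v v' e e_end
      in_ball_inv_word[of h v' N] path_end_inv_word[of h v']
    by (auto simp: in_ball_append s_def m_def)
qed

end

theorem theorem4p2:
  fixes G :: "('a, 'b) monoid_scheme" and X :: "'a set"
  assumes "group G"
    and "X \<subseteq> carrier G"
    and "finite X"
    and "generate G X = carrier G"
    and "basepoint_loop_shortening G X"
  shows "almost_convex G X"
proof -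
  interpret group G by (rule assms(1))
  interpret cayley_graph G X
    using assms(2,4) by unfold_locales
  obtain k where shortening: "\<forall>g w. loop_at G X g w \<and> length w > 0 \<longrightarrow>
      (\<exists>u. loop_at G X g u \<and> length u < length w \<and> fellow_travel G X k g w g u)"
    using assms(5) unfolding basepoint_loop_shortening_def by blast
  show ?thesis
    unfolding almost_convex_def
  proof (intro exI[of _ "real (12 * nat \<lfloor>k\<rfloor> + 2)"] allI ballI impI, elim conjE)
    fix N :: nat and g h
    assume gh: "g \<in> carrier G" "h \<in> carrier G"
      and d: "cayley_dist G X (Vertex g) (Vertex h) \<le> 2"
        "cayley_dist G X (Vertex \<one>\<^bsub>G\<^esub>) (Vertex g) \<le> real N"
        "cayley_dist G X (Vertex \<one>\<^bsub>G\<^esub>) (Vertex h) \<le> real N"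
    have "near 2 g h" "near N \<one>\<^bsub>G\<^esub> g" "near N \<one>\<^bsub>G\<^esub> h"
      using near_if_cayley_dist_le[OF gh d(1)] near_if_cayley_dist_le[OF one_closed gh(1) d(2)]
        near_if_cayley_dist_le[OF one_closed gh(2) d(3)] by simp_all
    then obtain w where w: "w \<in> words X" "path_end G g w = h" "length w \<le> 12 * nat \<lfloor>k\<rfloor> + 2"
        "in_ball N g w"
      by (rule connect_in_ball[OF shortening])
    show "\<exists>w\<in>words X. path_end G g w = h \<and> real (length w) \<le> real (12 * nat \<lfloor>k\<rfloor> + 2) \<and>
        (\<forall>t. 0 \<le> t \<and> t \<le> real (length w) \<longrightarrow>
          cayley_dist G X (Vertex \<one>\<^bsub>G\<^esub>) (path_point G g w t) \<le> real N)"
    proof (intro bexI[of _ w] conjI allI impI)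
      show "real (length w) \<le> real (12 * nat \<lfloor>k\<rfloor> + 2)"
        using w(3) by (simp only: of_nat_le_iff)
    qed (use w gh cayley_dist_path_point_le in auto)
  qed
qed

end
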